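(* Let $G$ and $H$ be disjoint connected graphs with the same number of vertices, let $f:V(G)\rightarrow V(H)$ be a bijection, and let $B(G,H,f)$ be the corresponding bijection graph. Then $\gamma_t(B(G,H,f))\leq a(B(G,H,f))+1$.
   Context: All graphs are finite and simple. $m(G)$ denotes the number of edges of $G$. A total dominating set of $G$ is a set $D\subseteq V(G)$ such that every vertex of $V(G)$ has a neighbor in $D$; the total domination number $\gamma_t(G)$ is the minimum cardinality of a total dominating set of $G$. If $d_1\leq d_2\leq\cdots\leq d_n$ is the ordered degree sequence of $G$, the annihilation number $a(G)$ is the largest integer $k$ with $k\le n$ such that $\sum_{i=1}^{k} d_i\leq m(G)$. The bijection graph $B(G,H,f)$ is obtained from the disjoint union of $G$ and $H$ by adding the edges $uf(u)$ for all $u\in V(G)$. *)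

theory Defs
  imports "Graph_Theory.Graph_Theory" "HOL-Library.Multiset"
begin

text \<open>
  A finite simple graph is a \<^locale>\<open>pair_graph\<close>: a finite vertex set with a finite, symmetric,
  loop-free set of arcs \<open>(u,v)\<close>.  Each undirected edge \<open>uv\<close> is represented by the two arcs
  \<open>(u,v)\<close> and \<open>(v,u)\<close>, so edges must be counted as unordered pairs, whereas the degree of a vertex
  is its \<^const>\<open>out_degree\<close>.
\<close>

definition edge_count :: "'a pair_pre_digraph \<Rightarrow> nat" where
  "edge_count G = card {{u, v} | u v. (u, v) \<in> parcs G}"

definition total_dominating_set :: "'a pair_pre_digraph \<Rightarrow> 'a set \<Rightarrow> bool" where
  "total_dominating_set G D \<longleftrightarrow>
     D \<subseteq> pverts G \<and> (\<forall>v \<in> pverts G. \<exists>u \<in> D. (v, u) \<in> parcs G)"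

text \<open>
  A graph with an isolated vertex has no total dominating set, and then the value below is
  unspecified; bijection graphs have no isolated vertices.
\<close>

definition total_domination_number :: "'a pair_pre_digraph \<Rightarrow> nat" where
  "total_domination_number G = (LEAST k. \<exists>D. total_dominating_set G D \<and> card D = k)"

definition degree_sequence :: "'a pair_pre_digraph \<Rightarrow> nat list" where
  "degree_sequence G =
     sorted_list_of_multiset (image_mset (out_degree (with_proj G)) (mset_set (pverts G)))"

text \<open>Lists are indexed from 0, so \<open>\<Sum>i<k\<close> below ranges over the \<open>k\<close> smallest degrees.\<close>

definition annihilation_number :: "'a pair_pre_digraph \<Rightarrow> nat" where
  "annihilation_number G =
     (GREATEST k. k \<le> card (pverts G) \<and> (\<Sum>i<k. degree_sequence G ! i) \<le> edge_count G)"

text \<open>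
  Both graphs live on the same vertex type, so the union is disjoint only if the vertex sets
  of \<open>G\<close> and \<open>H\<close> are; this has to be assumed where the construction is used.
\<close>

definition bijection_graph ::
  "'a pair_pre_digraph \<Rightarrow> 'a pair_pre_digraph \<Rightarrow> ('a \<Rightarrow> 'a) \<Rightarrow> 'a pair_pre_digraph" where
  "bijection_graph G H f =
     \<lparr> pverts = pverts G \<union> pverts H,
       parcs = parcs G \<union> parcs H
         \<union> {(u, f u) | u. u \<in> pverts G} \<union> {(f u, u) | u. u \<in> pverts G} \<rparr>"

lemma pair_graph_bijection_graph:
  assumes "pair_graph G" "pair_graph H" "pverts G \<inter> pverts H = {}"
    and "bij_betw f (pverts G) (pverts H)"
  shows "pair_graph (bijection_graph G H f)"
proof -
  interpret G: pair_graph G by fact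
  interpret H: pair_graph H by fact
  have fH: "f u \<in> pverts H" if "u \<in> pverts G" for u
    using that assms(4) by (auto simp: bij_betw_def)
  have fne: "f u \<noteq> u" if "u \<in> pverts G" for u
    using that fH[OF that] assms(3) by (metis disjoint_iff)
  have sG: "(v, u) \<in> parcs G" if "(u, v) \<in> parcs G" for u v
    using that G.graph_symmetric by simp
  have sH: "(v, u) \<in> parcs H" if "(u, v) \<in> parcs H" for u v
    using that H.graph_symmetric by simp
  show ?thesis
  proof
    show "finite (parcs (bijection_graph G H f))"
      by (simp add: bijection_graph_def)
    show "symmetric (with_proj (bijection_graph G H f))"
      unfolding symmetric_def by (rule symI) (auto simp: bijection_graph_def intro: sG sH)
  next
    fix e assume "e \<in> parcs (bijection_graph G H f)"
    then show "fst e \<noteq> snd e"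
      by (cases e) (auto simp: bijection_graph_def dest: G.no_loops' H.no_loops' fne)
  qed (auto simp: bijection_graph_def fH dest: G.wellformed' H.wellformed')
qed

end

theory Submission
  imports Defs
begin

text \<open>
  Write \<open>n\<close> for the common order of \<open>G\<close> and \<open>H\<close>, so that the bijection graph \<open>B\<close> has \<open>2n\<close>
  vertices.  The claim follows by comparing both sides with \<open>n\<close>.

  On the one hand \<open>n\<close> is a lower bound for the annihilation number: the smaller half of a degree
  sequence contributes at most half of the degree sum, and by the handshake lemma this half is the
  number of edges (\<open>half_order_le_annihilation_number\<close>).

  On the other hand, if \<open>n > 1\<close>, connectedness leaves \<open>G\<close> without isolated vertices
  (\<open>connected_imp_neighbour\<close>).  Then \<open>V(G)\<close> is a total dominating set of \<open>B\<close>: a vertex of \<open>G\<close> has a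
  neighbour within \<open>G\<close>, and a vertex of \<open>H\<close> has its matching partner in \<open>G\<close>.  So
  \<open>\<gamma>\<^sub>t(B) \<le> n \<le> a(B)\<close>.

  The additional \<open>1\<close> in the claim pays for \<open>n = 1\<close>, where \<open>B\<close> is a single edge: both of its vertices are needed
  to dominate totally, whereas its annihilation number is \<open>1\<close>.
\<close>

text \<open>
  Shifting the first \<open>k\<close> positions by \<open>k\<close> only increases the entries, and the shifted positions are
  disjoint from the original ones.
\<close>

lemma sorted_double_sum_prefix_le_sum_list:
  fixes xs :: "nat list"
  assumes "sorted xs" and "2 * k \<le> length xs"
  shows "2 * (\<Sum>i<k. xs ! i) \<le> sum_list xs"
proof -
  have "(\<Sum>i<k. xs ! i) \<le> (\<Sum>i<k. xs ! (i + k))"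
    using assms by (intro sum_mono sorted_nth_mono) auto
  moreover have "(\<Sum>i<k. xs ! (i + k)) = (\<Sum>i=k..<2 * k. xs ! i)"
    using sum.shift_bounds_nat_ivl[of "(!) xs" 0 k k] by (simp add: atLeast0LessThan mult_2)
  moreover have "(\<Sum>i<k. xs ! i) + (\<Sum>i=k..<2 * k. xs ! i) = (\<Sum>i=0..<2 * k. xs ! i)"
    by (simp add: lessThan_atLeast0 sum.atLeastLessThan_concat)
  moreover have "(\<Sum>i=0..<2 * k. xs ! i) \<le> (\<Sum>i=0..<length xs. xs ! i)"
    using assms by (intro sum_mono2) auto
  ultimately show ?thesis
    by (simp add: sum_list_sum_nth)
qed

lemma (in pair_fin_digraph) sum_out_degree_eq_card_parcs:
  "(\<Sum>v\<in>pverts G. out_degree (with_proj G) v) = card (parcs G)"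
proof -
  have "parcs G = (\<Union>v\<in>pverts G. out_arcs (with_proj G) v)"
    by (auto simp: out_arcs_def dest: wellformed')
  moreover have "card (\<Union>v\<in>pverts G. out_arcs (with_proj G) v)
      = (\<Sum>v\<in>pverts G. card (out_arcs (with_proj G) v))"
    by (rule card_UN_disjoint) (auto simp: out_arcs_def)
  ultimately show ?thesis
    by (simp add: out_degree_def)
qed

text \<open>
  Each unordered pair comes from at most two arcs.  This is the half of the handshake lemma that
  bounds the degree sum from above.
\<close>

lemma (in pair_fin_digraph) card_parcs_le_double_edge_count:
  "card (parcs G) \<le> 2 * edge_count G"
proof -
  define ends where "ends a = {fst a, snd a}" for a :: "'a \<times> 'a"
  have "{{u, v} | u v. (u, v) \<in> parcs G} = ends ` parcs G"
    unfolding ends_def image_def by (simp add: Bex_def split_paired_Ex conj_commute)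
  then have edges: "edge_count G = card (ends ` parcs G)"
    by (simp only: edge_count_def)
  have fibre: "card {a \<in> parcs G. ends a = e} \<le> 2" if "e \<in> ends ` parcs G" for e
  proof -
    from that obtain b where b: "e = ends b"
      by (rule imageE)
    have "{a \<in> parcs G. ends a = e} \<subseteq> {b, prod.swap b}"
      unfolding b ends_def by (clarsimp simp: doubleton_eq_iff prod_eq_iff)
    then have "card {a \<in> parcs G. ends a = e} \<le> card {b, prod.swap b}"
      by (rule card_mono[rotated]) simp
    also have "\<dots> \<le> 2"
      by (simp add: card_insert_if)
    finally show ?thesis .
  qed
  have "card (parcs G) = (\<Sum>e\<in>ends ` parcs G. card {a \<in> parcs G. ends a = e})"
    using sum.image_gen[of "parcs G" "\<lambda>_. 1 :: nat" ends] by simp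
  also have "\<dots> \<le> 2 * card (ends ` parcs G)"
    using sum_bounded_above[of "ends ` parcs G" "\<lambda>e. card {a \<in> parcs G. ends a = e}" 2, OF fibre]
    by simp
  finally show ?thesis
    by (simp only: edges)
qed

lemma (in pair_fin_digraph) half_order_le_annihilation_number:
  "card (pverts G) div 2 \<le> annihilation_number G"
proof -
  let ?k = "card (pverts G) div 2"
  let ?d = "degree_sequence G"
  have mset_d: "mset ?d = image_mset (out_degree (with_proj G)) (mset_set (pverts G))"
    by (simp add: degree_sequence_def)
  have "sum_list ?d = (\<Sum>v\<in>pverts G. out_degree (with_proj G) v)"
    using arg_cong[OF mset_d, of sum_mset]
    by (simp only: sum_mset_sum_list sum_unfold_sum_mset)
  moreover have "length ?d = card (pverts G)"
    using arg_cong[OF mset_d, of size] by simp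
  then have "2 * (\<Sum>i<?k. ?d ! i) \<le> sum_list ?d"
    by (intro sorted_double_sum_prefix_le_sum_list) (simp_all add: degree_sequence_def)
  ultimately have "(\<Sum>i<?k. ?d ! i) \<le> edge_count G"
    using sum_out_degree_eq_card_parcs card_parcs_le_double_edge_count by simp
  then show ?thesis
    unfolding annihilation_number_def
    by (auto intro: Greatest_le_nat[where b = "card (pverts G)"])
qed

text \<open>A walk from a vertex to another one has a first step.\<close>

lemma (in pair_graph) connected_imp_neighbour:
  assumes "Digraph_Component.connected (with_proj G)"
    and "card (pverts G) > 1" and "v \<in> pverts G"
  obtains w where "(v, w) \<in> parcs G"
proof -
  have "pverts G - {v} \<noteq> {}"
    using assms(2,3) by (metis One_nat_def card_1_singleton_iff insert_Diff less_irrefl)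
  then obtain x where x: "x \<in> pverts G" "x \<noteq> v"
    by auto
  have "v \<rightarrow>\<^sup>*\<^bsub>mk_symmetric (with_proj G)\<^esub> x"
    using assms(1,3) x(1)
    by (simp add: Digraph_Component.connected_def strongly_connected_def)
  then have "v \<rightarrow>\<^sup>*\<^bsub>with_proj G\<^esub> x"
    by (simp only: reachable_mk_symmetric_eq[OF sym_arcs])
  then show ?thesis
    using x(2) that by (cases rule: converse_reachable_cases) auto
qed

lemma total_domination_number_le_card:
  assumes "total_dominating_set G D"
  shows "total_domination_number G \<le> card D"
  unfolding total_domination_number_def using assms by (intro Least_le) auto

lemma total_dominating_set_bijection_graph_left:
  assumes "bij_betw f (pverts G) (pverts H)"
    and "\<And>v. v \<in> pverts G \<Longrightarrow> \<exists>w\<in>pverts G. (v, w) \<in> parcs G"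
  shows "total_dominating_set (bijection_graph G H f) (pverts G)"
  unfolding total_dominating_set_def
proof (intro conjI ballI)
  fix v assume "v \<in> pverts (bijection_graph G H f)"
  then consider "v \<in> pverts G" | u where "u \<in> pverts G" "v = f u"
    using assms(1) by (auto simp: bijection_graph_def bij_betw_def)
  then show "\<exists>u\<in>pverts G. (v, u) \<in> parcs (bijection_graph G H f)"
    using assms(2) by cases (auto simp: bijection_graph_def)
qed (auto simp: bijection_graph_def)

text \<open>The matching edges alone already provide every vertex with a neighbour.\<close>

lemma total_dominating_set_bijection_graph_all:
  assumes "bij_betw f (pverts G) (pverts H)"
  shows "total_dominating_set (bijection_graph G H f) (pverts G \<union> pverts H)"
  unfolding total_dominating_set_def
proof (intro conjI ballI)
  fix v assume "v \<in> pverts (bijection_graph G H f)"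
  then consider "v \<in> pverts G" | u where "u \<in> pverts G" "v = f u"
    using assms by (auto simp: bijection_graph_def bij_betw_def)
  then show "\<exists>u\<in>pverts G \<union> pverts H. (v, u) \<in> parcs (bijection_graph G H f)"
    using assms by cases (auto simp: bijection_graph_def dest: bij_betwE)
qed (auto simp: bijection_graph_def)

theorem proposition3p3:
  fixes G H :: "'a pair_pre_digraph" and f :: "'a \<Rightarrow> 'a"
  assumes "pair_graph G" and "pair_graph H"
    and "Digraph_Component.connected (with_proj G)"
    and "Digraph_Component.connected (with_proj H)"
    and "pverts G \<inter> pverts H = {}"
    and "card (pverts G) = card (pverts H)"
    and "bij_betw f (pverts G) (pverts H)"
  shows "total_domination_number (bijection_graph G H f)
           \<le> annihilation_number (bijection_graph G H f) + 1"
proof -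
  let ?B = "bijection_graph G H f"
  interpret G: pair_graph G by fact
  interpret H: pair_graph H by fact
  interpret B: pair_graph ?B
    using assms by (intro pair_graph_bijection_graph)
  have order: "card (pverts G \<union> pverts H) = 2 * card (pverts G)"
    using assms(5,6) by (simp add: card_Un_disjoint)
  then have annihilation: "card (pverts G) \<le> annihilation_number ?B"
    using B.half_order_le_annihilation_number by (simp add: bijection_graph_def)
  show ?thesis
  proof (cases "card (pverts G) > 1")
    case True
    have "\<exists>w\<in>pverts G. (v, w) \<in> parcs G" if "v \<in> pverts G" for v
    proof -
      obtain w where "(v, w) \<in> parcs G"
        using G.connected_imp_neighbour[OF assms(3) True \<open>v \<in> pverts G\<close>] .
      moreover from this have "w \<in> pverts G"
        using G.wellformed' by blast
      ultimately show ?thesis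
        by blast
    qed
    then have "total_domination_number ?B \<le> card (pverts G)"
      using assms(7)
      by (intro total_domination_number_le_card total_dominating_set_bijection_graph_left)
    then show ?thesis
      using annihilation by simp
  next
    case False
    \<comment> \<open>For \<open>n \<le> 1\<close> the bound \<open>2n\<close> obtained from all vertices is at most \<open>n + 1\<close>.\<close>
    have "total_domination_number ?B \<le> 2 * card (pverts G)"
      using total_domination_number_le_card[OF total_dominating_set_bijection_graph_all[OF assms(7)]]
      by (simp add: order)
    then show ?thesis
      using annihilation False by simp
  qed
qed

end
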